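(* Let $H$ be a digraph (possibly with loops), $D$ an $H$-colored digraph and $\mathscr{F}$ an $H$-class partition of $A(D)$. If for every $F\in\mathscr{F}$ the digraph $D\langle F\rangle$ is strongly connected, then for every $k\geq 2$ and $l\geq k+1$, $D$ has a $(k,l,H)$-kernel by walks.
   Context: An $H$-colored digraph is a finite digraph $D$ without loops with a coloring $\rho:A(D)\to V(H)$. For $F\subseteq A(D)$, $D\langle F\rangle$ is the digraph with arc set $F$ and vertex set the vertices incident with an arc of $F$. An $H$-class partition of $A(D)$ is a partition $\mathscr{F}$ of $A(D)$ such that for all arcs $(u,v),(v,w)$ of $D$, $(\rho(u,v),\rho(v,w))\in A(H)$ iff some $F\in\mathscr{F}$ contains both arcs. For a walk $W=(x_0,\ldots,x_n)$ in $D$, there is an obstruction on $x_i$ if $(\rho(x_{i-1},x_i),\rho(x_i,x_{i+1}))\notin A(H)$; for open $W$, the $H$-length $l_H(W)$ is $1$ plus the number of $i\in\{1,\dots,n-1\}$ with an obstruction on $x_i$. A set $S\subseteq V(D)$ is a $(k,l,H)$-kernel by walks ($k\ge2$, $l\ge1$) if every walk between two different vertices of $S$ has $H$-length at least $k$ and every $x\in V(D)\setminus S$ has a walk to a vertex of $S$ of $H$-length at most $l$. *)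

theory Defs
  imports "Graph_Theory.Graph_Theory" "HOL-Library.Disjoint_Sets"
begin

definition H_colored_digraph ::
  "'c pair_pre_digraph \<Rightarrow> 'a pair_pre_digraph \<Rightarrow> ('a \<times> 'a \<Rightarrow> 'c) \<Rightarrow> bool" where
  "H_colored_digraph H D \<rho> \<longleftrightarrow>
     pair_wf_digraph H \<and> pair_digraph D \<and> (\<forall>e \<in> parcs D. \<rho> e \<in> pverts H)"

definition arc_subdigraph :: "('a \<times> 'a) set \<Rightarrow> 'a pair_pre_digraph" where
  "arc_subdigraph F = \<lparr> pverts = fst ` F \<union> snd ` F, parcs = F \<rparr>"

definition H_class_partition ::
  "'c pair_pre_digraph \<Rightarrow> 'a pair_pre_digraph \<Rightarrow> ('a \<times> 'a \<Rightarrow> 'c) \<Rightarrow> ('a \<times> 'a) set set \<Rightarrow> bool" where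
  "H_class_partition H D \<rho> \<F> \<longleftrightarrow>
     partition_on (parcs D) \<F> \<and>
     (\<forall>u v w. (u, v) \<in> parcs D \<longrightarrow> (v, w) \<in> parcs D \<longrightarrow>
        ((\<rho> (u, v), \<rho> (v, w)) \<in> parcs H \<longleftrightarrow> (\<exists>F \<in> \<F>. (u, v) \<in> F \<and> (v, w) \<in> F)))"

text \<open>A walk is given by its list of vertices; since digraphs here have no parallel arcs,
  this determines its arcs. Only the internal positions of the walk can carry an obstruction.\<close>

definition obstruction ::
  "'c pair_pre_digraph \<Rightarrow> ('a \<times> 'a \<Rightarrow> 'c) \<Rightarrow> 'a list \<Rightarrow> nat \<Rightarrow> bool" where
  "obstruction H \<rho> W i \<longleftrightarrow> (\<rho> (W ! (i - 1), W ! i), \<rho> (W ! i, W ! (i + 1))) \<notin> parcs H"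

text \<open>This is the length of an open walk only: for a closed walk, the turn at
  its base point would not be counted.\<close>

definition H_length :: "'c pair_pre_digraph \<Rightarrow> ('a \<times> 'a \<Rightarrow> 'c) \<Rightarrow> 'a list \<Rightarrow> nat" where
  "H_length H \<rho> W = 1 + card {i. 1 \<le> i \<and> i < length W - 1 \<and> obstruction H \<rho> W i}"

definition walk_from_to :: "'a pair_pre_digraph \<Rightarrow> 'a \<Rightarrow> 'a list \<Rightarrow> 'a \<Rightarrow> bool" where
  "walk_from_to D x W y \<longleftrightarrow> vwalk W (with_proj D) \<and> hd W = x \<and> last W = y"

definition kl_H_kernel_by_walks ::
  "nat \<Rightarrow> nat \<Rightarrow> 'c pair_pre_digraph \<Rightarrow> 'a pair_pre_digraph \<Rightarrow> ('a \<times> 'a \<Rightarrow> 'c) \<Rightarrow> 'a set \<Rightarrow> bool" where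
  "kl_H_kernel_by_walks k l H D \<rho> S \<longleftrightarrow>
     2 \<le> k \<and> 1 \<le> l \<and> S \<subseteq> pverts D \<and>
     (\<forall>x \<in> S. \<forall>y \<in> S. \<forall>W. x \<noteq> y \<longrightarrow> walk_from_to D x W y \<longrightarrow> k \<le> H_length H \<rho> W) \<and>
     (\<forall>x \<in> pverts D - S. \<exists>y \<in> S. \<exists>W. walk_from_to D x W y \<and> H_length H \<rho> W \<le> l)"

end

theory Submission
  imports Defs
begin

text \<open>A walk changes its class exactly at its obstructions. Since every class is strongly connected,
  any two of its vertices are joined inside the class by a walk of \<open>H\<close>-length 1. So \<open>H\<close>-distance
  is distance for the symmetric relation ``lie in a common class'', and a maximal set of vertices at
  pairwise distance at least \<open>k\<close> absorbs every other vertex already within distance \<open>k - 1\<close>.\<close>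

section \<open>\<open>H_length\<close> under extension and concatenation of walks\<close>

lemma H_length_singleton [simp]: "H_length H \<rho> [x] = 1"
  and H_length_arc [simp]: "H_length H \<rho> [x, y] = 1"
  by (auto simp: H_length_def)

text \<open>Turns the count over positions into a recursion: position 1 is the new turn at
  \<open>v\<close>, and every later position is one of the tail shifted by
  \<open>Suc\<close>.\<close>

lemma H_length_Cons [simp]:
  "H_length H \<rho> (u # v # w # r) =
     (if (\<rho> (u, v), \<rho> (v, w)) \<in> parcs H then 0 else 1) + H_length H \<rho> (v # w # r)"
proof -
  let ?O = "\<lambda>W. {i. 1 \<le> i \<and> i < length W - 1 \<and> obstruction H \<rho> W i}"
  have "i \<in> ?O (u # v # w # r) \<longleftrightarrow>
      i \<in> (if (\<rho> (u, v), \<rho> (v, w)) \<in> parcs H then {} else {1}) \<union> Suc ` ?O (v # w # r)" for i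
  proof (cases "i \<le> 1")
    case True
    then have "i = 0 \<or> i = 1" by auto
    then show ?thesis by (auto simp: obstruction_def)
  next
    case False
    then obtain j where "i = Suc (Suc j)"
      by (metis One_nat_def le_SucI nat.exhaust le_refl zero_le)
    then show ?thesis by (auto simp: obstruction_def image_iff)
  qed
  then have "?O (u # v # w # r) =
      (if (\<rho> (u, v), \<rho> (v, w)) \<in> parcs H then {} else {1}) \<union> Suc ` ?O (v # w # r)"
    by blast
  then have "card (?O (u # v # w # r)) =
      card ((if (\<rho> (u, v), \<rho> (v, w)) \<in> parcs H then {} else {1}) \<union> Suc ` ?O (v # w # r))"
    by (rule arg_cong)
  also have "\<dots> = card (if (\<rho> (u, v), \<rho> (v, w)) \<in> parcs H then {} else {1 :: nat})
      + card (Suc ` ?O (v # w # r))"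
    by (rule card_Un_disjoint) auto
  also have "\<dots> = (if (\<rho> (u, v), \<rho> (v, w)) \<in> parcs H then 0 else 1) + card (?O (v # w # r))"
    by (simp add: card_image)
  finally show ?thesis
    unfolding H_length_def by simp
qed

lemma H_length_Cons_le: "H_length H \<rho> (u # p) \<le> Suc (H_length H \<rho> p)"
proof (cases p rule: vwalk_arcs.cases)
  case 1
  then show ?thesis by (simp add: H_length_def)
qed simp_all

text \<open>The junction adds at most one obstruction, and the sum on the right has room for it
  because each summand carries its own initial 1.\<close>

lemma H_length_append_le:
  assumes "p \<noteq> []" "q \<noteq> []" "last p = hd q"
  shows "H_length H \<rho> (p @ tl q) \<le> H_length H \<rho> p + H_length H \<rho> q"
  using assms
proof (induction p rule: vwalk_arcs.induct)
  case (2 x)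
  then show ?case by (cases q) auto
next
  case (3 u v p)
  show ?case
  proof (cases p)
    case Nil
    \<comment> \<open>Here \<open>v\<close> is the junction \<open>hd q\<close>, which
      \<open>tl q\<close> drops. The possible obstruction at \<open>v\<close> is paid for by
      \<open>H_length H \<rho> [u, v] = 1\<close>.\<close>
    then have "u # v # p @ tl q = u # q" using 3 by (cases q) auto
    then show ?thesis using Nil H_length_Cons_le[of H \<rho> u q] by simp
  next
    case (Cons w r)
    have "H_length H \<rho> ((v # p) @ tl q) \<le> H_length H \<rho> (v # p) + H_length H \<rho> q"
      using 3 Cons by auto
    then show ?thesis using Cons by simp
  qed
qed simp

lemma walk_from_to_append:
  assumes "walk_from_to D x p y" "walk_from_to D y q z"
  shows "walk_from_to D x (p @ tl q) z"
proof -
  have "p \<noteq> []" "q \<noteq> []" "joinable p q"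
    using assms by (auto simp: walk_from_to_def joinable_def elim: vwalkE)
  then have "vwalk (p \<oplus> q) (with_proj D)" "hd (p \<oplus> q) = x" "last (p \<oplus> q) = z"
    using assms vwalk_joinI_vwalk[of p "with_proj D" q]
    by (simp_all add: walk_from_to_def vwalk_join_hd vwalk_join_last)
  then show ?thesis by (simp add: walk_from_to_def vwalk_join_def)
qed

text \<open>Reflexive only on vertices incident with an arc of some class. A vertex may lie in
  several classes, so transitivity can fail and powers of the relation measure a distance.\<close>

definition common_class :: "('a \<times> 'a) set set \<Rightarrow> 'a rel" where
  "common_class \<F> = {(x, y). \<exists>F \<in> \<F>. {x, y} \<subseteq> pverts (arc_subdigraph F)}"

lemma sym_relpow:
  assumes "sym R"
  shows "sym (R ^^ n)"
proof (induction n)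
  case (Suc n)
  show ?case
  proof (rule symI)
    fix x y
    assume "(x, y) \<in> R ^^ Suc n"
    then obtain z where "(x, z) \<in> R ^^ n" "(z, y) \<in> R" by auto
    then have "(y, z) \<in> R" "(z, x) \<in> R ^^ n"
      using assms Suc by (auto dest: symD)
    then show "(y, x) \<in> R ^^ Suc n" by (rule relpow_Suc_I2)
  qed
qed (simp add: sym_Id)

lemma sym_common_class: "sym (common_class \<F>)"
  by (auto simp: sym_def common_class_def)

section \<open>From walks to chains of classes\<close>

context
  fixes H :: "'c pair_pre_digraph" and D :: "'a pair_pre_digraph"
    and \<rho> :: "'a \<times> 'a \<Rightarrow> 'c" and \<F> :: "('a \<times> 'a) set set"
  assumes partition: "H_class_partition H D \<rho> \<F>"
begin

lemma class_cases:
  assumes "e \<in> parcs D"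
  obtains F where "F \<in> \<F>" "e \<in> F"
  using assms partition unfolding H_class_partition_def partition_on_def by blast

lemma class_subset: "F \<in> \<F> \<Longrightarrow> F \<subseteq> parcs D"
  using partition unfolding H_class_partition_def partition_on_def by blast

lemma class_unique: "F \<in> \<F> \<Longrightarrow> G \<in> \<F> \<Longrightarrow> e \<in> F \<Longrightarrow> e \<in> G \<Longrightarrow> F = G"
  using partition unfolding H_class_partition_def partition_on_def disjoint_def by blast

lemma consecutive_arcs_iff:
  assumes "F \<in> \<F>" "G \<in> \<F>" "(u, v) \<in> F" "(v, w) \<in> G"
  shows "(\<rho> (u, v), \<rho> (v, w)) \<in> parcs H \<longleftrightarrow> F = G"
proof -
  have "(\<rho> (u, v), \<rho> (v, w)) \<in> parcs H \<longleftrightarrow> (\<exists>F \<in> \<F>. (u, v) \<in> F \<and> (v, w) \<in> F)"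
    using assms class_subset partition unfolding H_class_partition_def by blast
  then show ?thesis using assms class_unique by blast
qed

text \<open>The exponent is the number of obstructions. Leaving the start \<open>z\<close> free in
  the class of the first arc makes the induction work: an arc prepended in the same class keeps
  \<open>z\<close>.\<close>

lemma vwalk_imp_common_class_pow:
  assumes "vwalk (u # v # p) (with_proj D)" "F \<in> \<F>" "(u, v) \<in> F"
  shows "\<exists>z \<in> pverts (arc_subdigraph F).
    (z, last (v # p)) \<in> common_class \<F> ^^ (H_length H \<rho> (u # v # p) - 1)"
  using assms
proof (induction p arbitrary: u v F)
  case Nil
  then show ?case by (force simp: arc_subdigraph_def)
next
  case (Cons w r)
  have walk: "vwalk (v # w # r) (with_proj D)" and arc: "(v, w) \<in> parcs D"
    using Cons.prems by (auto simp: vwalk_def)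
  from arc obtain G where G: "G \<in> \<F>" "(v, w) \<in> G" by (rule class_cases)
  obtain z where z: "z \<in> pverts (arc_subdigraph G)"
    "(z, last (w # r)) \<in> common_class \<F> ^^ (H_length H \<rho> (v # w # r) - 1)"
    using Cons.IH[OF walk G] by blast
  note iff = consecutive_arcs_iff[OF Cons.prems(2) G(1) Cons.prems(3) G(2)]
  show ?case
  proof (cases "F = G")
    case True
    then show ?thesis using z iff by auto
  next
    case False
    \<comment> \<open>The class changes at \<open>v\<close>, which lies in both \<open>F\<close> and
      \<open>G\<close>. So \<open>v\<close> is the new witness for \<open>F\<close>, and the step
      from \<open>v\<close> to \<open>z\<close> inside \<open>G\<close> accounts for the
      obstruction.\<close>
    have "(v, z) \<in> common_class \<F>"
      using z G by (force simp: common_class_def arc_subdigraph_def)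
    then have "(v, last (w # r)) \<in> common_class \<F> ^^ Suc (H_length H \<rho> (v # w # r) - 1)"
      using z(2) by (rule relpow_Suc_I2)
    moreover have "v \<in> pverts (arc_subdigraph F)"
      using Cons.prems by (force simp: arc_subdigraph_def)
    ultimately show ?thesis using False iff
      by (intro bexI[of _ v]) (simp_all add: H_length_def[of H \<rho> "v # w # r"] del: relpow.simps)
  qed
qed

text \<open>One more step, inside the class of the first arc, raises the exponent from the number of
  obstructions to the \<open>H_length\<close>. Distinct ends exclude the one-vertex walk, whose
  vertex may be isolated and then unrelated to itself.\<close>

lemma walk_imp_common_class_pow:
  assumes "walk_from_to D x W y" "x \<noteq> y"
  shows "(x, y) \<in> common_class \<F> ^^ H_length H \<rho> W"
proof -
  obtain v p where W: "W = x # v # p"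
    using assms by (cases W rule: vwalk_arcs.cases) (auto simp: walk_from_to_def)
  then have "(x, v) \<in> parcs D" using assms by (auto simp: walk_from_to_def vwalk_def)
  then obtain F where F: "F \<in> \<F>" "(x, v) \<in> F" by (rule class_cases)
  obtain z where z: "z \<in> pverts (arc_subdigraph F)"
    "(z, y) \<in> common_class \<F> ^^ (H_length H \<rho> W - 1)"
    using vwalk_imp_common_class_pow[of x v p F] assms F W by (auto simp: walk_from_to_def)
  have "(x, z) \<in> common_class \<F>"
    using z F by (force simp: common_class_def arc_subdigraph_def)
  then have "(x, y) \<in> common_class \<F> ^^ Suc (H_length H \<rho> W - 1)"
    using z(2) by (rule relpow_Suc_I2)
  then show ?thesis by (simp add: H_length_def del: relpow.simps)
qed

lemma vwalk_in_class_H_length: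
  assumes "F \<in> \<F>" "vwalk W (with_proj (arc_subdigraph F))"
  shows "H_length H \<rho> W = 1"
  using assms(2)
proof (induction W rule: vwalk_arcs.induct)
  case (3 u v p)
  have walk: "vwalk (v # p) (with_proj (arc_subdigraph F))"
    using 3 by (auto simp: vwalk_def)
  have len: "H_length H \<rho> (v # p) = 1"
    using 3 walk by auto
  show ?case
  proof (cases p)
    case (Cons w r)
    have "(u, v) \<in> F" "(v, w) \<in> F"
      using 3 Cons by (auto simp: vwalk_def arc_subdigraph_def)
    then show ?thesis using len Cons consecutive_arcs_iff[OF assms(1) assms(1)] by simp
  qed simp
qed (auto simp: vwalk_def)

section \<open>From chains of classes back to walks\<close>

context
  assumes wf: "pair_wf_digraph D"
    and connected: "\<And>F. F \<in> \<F> \<Longrightarrow> strongly_connected (with_proj (arc_subdigraph F))"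
begin

lemma common_class_imp_walk:
  assumes "(x, y) \<in> common_class \<F>"
  shows "\<exists>W. walk_from_to D x W y \<and> H_length H \<rho> W = 1"
proof -
  obtain F where F: "F \<in> \<F>" "x \<in> pverts (arc_subdigraph F)" "y \<in> pverts (arc_subdigraph F)"
    using assms by (auto simp: common_class_def)
  \<comment> \<open>Well-formedness lets reachability inside the class be read as a vertex
    list.\<close>
  interpret F: pair_wf_digraph "arc_subdigraph F"
    by unfold_locales (force simp: arc_subdigraph_def)+
  have "x \<rightarrow>\<^sup>*\<^bsub>with_proj (arc_subdigraph F)\<^esub> y"
    using connected[OF F(1)] F unfolding strongly_connected_def by simp
  then obtain W where W: "vwalk W (with_proj (arc_subdigraph F))" "hd W = x" "last W = y"
    using F.reachable_vwalk_conv by auto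
  have "pverts (arc_subdigraph F) \<subseteq> pverts D" "parcs (arc_subdigraph F) \<subseteq> parcs D"
    using class_subset[OF F(1)] wf by (force simp: arc_subdigraph_def pair_wf_digraph_def)+
  then have "vwalk W (with_proj D)"
    using W(1) by (auto simp: vwalk_def)
  then show ?thesis
    using W vwalk_in_class_H_length[OF F(1)] by (auto simp: walk_from_to_def)
qed

text \<open>Each step costs one class walk of \<open>H_length\<close> 1, and lengths add at most.
  The exponent starts at 1 because even a one-vertex walk has \<open>H_length\<close> 1.\<close>

lemma common_class_pow_imp_walk:
  assumes "(x, y) \<in> common_class \<F> ^^ Suc n"
  shows "\<exists>W. walk_from_to D x W y \<and> H_length H \<rho> W \<le> Suc n"
  using assms
proof (induction n arbitrary: y)
  case 0
  then show ?case using common_class_imp_walk by force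
next
  case (Suc n)
  obtain z where z: "(x, z) \<in> common_class \<F> ^^ Suc n" "(z, y) \<in> common_class \<F>"
    using Suc.prems by auto
  obtain p where p: "walk_from_to D x p z" "H_length H \<rho> p \<le> Suc n"
    using Suc.IH[OF z(1)] by blast
  obtain q where q: "walk_from_to D z q y" "H_length H \<rho> q = 1"
    using common_class_imp_walk[OF z(2)] by blast
  have "H_length H \<rho> (p @ tl q) \<le> H_length H \<rho> p + H_length H \<rho> q"
    using p q by (intro H_length_append_le) (auto simp: walk_from_to_def)
  then show ?case
    using walk_from_to_append[OF p(1) q(1)] p(2) q(2) by fastforce
qed

end

end

section \<open>Maximal independent sets and the kernel\<close>

lemma exists_maximal_independent_set:
  assumes "finite V" "sym R"
  obtains S where "S \<subseteq> V" "\<And>x y. x \<in> S \<Longrightarrow> y \<in> S \<Longrightarrow> x \<noteq> y \<Longrightarrow> (x, y) \<notin> R"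
    "\<And>x. x \<in> V - S \<Longrightarrow> \<exists>y \<in> S. x \<noteq> y \<and> (x, y) \<in> R"
proof -
  let ?I = "{S. S \<subseteq> V \<and> (\<forall>x \<in> S. \<forall>y \<in> S. x \<noteq> y \<longrightarrow> (x, y) \<notin> R)}"
  have "finite ?I" using assms(1) by simp
  moreover have "{} \<in> ?I" by simp
  ultimately obtain S where S: "S \<in> ?I" and max: "\<And>T. T \<in> ?I \<Longrightarrow> S \<subseteq> T \<Longrightarrow> S = T"
    using finite_has_maximal[of ?I] by (metis (no_types, lifting) empty_iff)
  have "\<exists>y \<in> S. x \<noteq> y \<and> (x, y) \<in> R" if x: "x \<in> V - S" for x
  proof (rule ccontr)
    assume "\<not> ?thesis"
    \<comment> \<open>Symmetry handles the pairs in which \<open>x\<close> is the second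
      entry.\<close>
    then have "insert x S \<in> ?I" using S x assms(2) by (auto dest: symD)
    then show False using max[of "insert x S"] x by blast
  qed
  then show thesis using S by (intro that[of S]) auto
qed

theorem theorem8:
  fixes H :: "'c pair_pre_digraph"
    and D :: "'a pair_pre_digraph"
    and \<rho> :: "'a \<times> 'a \<Rightarrow> 'c"
    and \<F> :: "('a \<times> 'a) set set"
    and k l :: nat
  assumes "H_colored_digraph H D \<rho>"
    and "H_class_partition H D \<rho> \<F>"
    and "\<And>F. F \<in> \<F> \<Longrightarrow> strongly_connected (with_proj (arc_subdigraph F))"
    and "k \<ge> 2"
    and "l \<ge> k + 1"
  shows "\<exists>S. kl_H_kernel_by_walks k l H D \<rho> S"
proof -
  interpret D: pair_digraph D
    using assms(1) by (simp add: H_colored_digraph_def)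
  \<comment> \<open>Distance less than \<open>k\<close>. The power 0 contributes only the identity,
    which is harmless since independence concerns distinct vertices.\<close>
  let ?R = "\<Union>n<k. common_class \<F> ^^ n"
  have "sym ?R"
    by (intro sym_UNION ballI sym_relpow sym_common_class)
  then obtain S where S: "S \<subseteq> pverts D"
    and indep: "\<And>x y. x \<in> S \<Longrightarrow> y \<in> S \<Longrightarrow> x \<noteq> y \<Longrightarrow> (x, y) \<notin> ?R"
    and absorb: "\<And>x. x \<in> pverts D - S \<Longrightarrow> \<exists>y \<in> S. x \<noteq> y \<and> (x, y) \<in> ?R"
    using exists_maximal_independent_set[OF D.pair_finite_verts] by metis
  have "k \<le> H_length H \<rho> W"
    if "x \<in> S" "y \<in> S" "x \<noteq> y" "walk_from_to D x W y" for x y W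
    \<comment> \<open>A walk of \<open>H_length\<close> below \<open>k\<close> would put
      \<open>(x, y)\<close> into \<open>?R\<close>.\<close>
    using indep[OF that(1-3)] walk_imp_common_class_pow[OF assms(2) that(4) that(3)]
    by (meson UN_I lessThan_iff not_le)
  moreover have "\<exists>y \<in> S. \<exists>W. walk_from_to D x W y \<and> H_length H \<rho> W \<le> l"
    if x: "x \<in> pverts D - S" for x
  proof -
    obtain y n where y: "y \<in> S" "x \<noteq> y" "n < k" "(x, y) \<in> common_class \<F> ^^ n"
      using absorb[OF x] by auto
    \<comment> \<open>The power 0 is the identity, so \<open>x \<noteq> y\<close> forces a positive
      exponent.\<close>
    then obtain m where m: "n = Suc m" by (cases n) auto
    obtain W where "walk_from_to D x W y" "H_length H \<rho> W \<le> n"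
      using common_class_pow_imp_walk[OF assms(2) D.pair_wf_digraph_axioms assms(3)] y(4) m by blast
    then show ?thesis using y assms(5) by force
  qed
  ultimately show ?thesis
    using S assms(4,5) unfolding kl_H_kernel_by_walks_def by (intro exI[of _ S]) auto
qed

end
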